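(* For $j\in\{1,\dots,n\}$, let $\boldsymbol{r}_j$ be the $j$-th generator of $\mathbb{S}(n,N)$. Then $$\sum_{j=1}^{n}h(\boldsymbol{r}_j)=Nn+\frac{n(n-1)}{2}.$$
   Context: Fix $n\in\mathbb{N}$ and $N\in\mathbb{N}$ (positive integers). $\mathbb{P}$ is the space of $n$-dimensional vector polynomials $\boldsymbol{p}(z)=(P_1(z),\dots,P_n(z))^t$, where each $P_k$ is a scalar polynomial with complex coefficients. It is a complex vector space and a module over the ring of scalar polynomials. Height: for nonzero $\boldsymbol{p}\in\mathbb{P}$, $h(\boldsymbol{p}):=\max_{j\in\{1,\dots,n\}}\{n\deg P_j+j-1\}$ with $\deg 0=-\infty$; and $h(0):=-\infty$. For a subset $\mathcal{M}\subset\mathbb{P}$ containing a nonzero element, $h(\mathcal{M}):=\min\{h(\boldsymbol{q}):\boldsymbol{q}\in\mathcal{M},\ \boldsymbol{q}\neq 0\}$. Interpolation problem: given are nodes $z_1,\dots,z_N\in\mathbb{C}$, not necessarily pairwise different, and complex numbers $\alpha_k(j)$ ($k=1,\dots,n$, $j=1,\dots,N$) with $\sum_{k=1}^n|\alpha_k(j)|>0$ for every $j$. Standing assumption: the vectors $\boldsymbol{\alpha}(j)=(\alpha_1(j),\dots,\alpha_n(j))^t$ belonging to coinciding nodes are linearly independent (i.e. for each $w\in\mathbb{C}$ the family $\{\boldsymbol{\alpha}(j): z_j=w\}$, indexed by $j$, is linearly independent). $\mathbb{S}(n,N)$ denotes the set of all $\boldsymbol{p}\in\mathbb{P}$ such that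 $\sum_{k=1}^n\alpha_k(j)P_k(z_j)=0$ for all $j\in\{1,\dots,N\}$. Generators: for $\boldsymbol{r}\in\mathbb{P}$ let $\mathbb{M}(\boldsymbol{r}):=\{S\boldsymbol{r}: S \text{ a scalar polynomial}\}$. A first generator of $\mathbb{S}(n,N)$ is an element $\boldsymbol{r}_1\in\mathbb{S}(n,N)$ with $h(\boldsymbol{r}_1)=h(\mathbb{S}(n,N))$; put $\mathbb{M}_1:=\mathbb{M}(\boldsymbol{r}_1)$. Recursively, for $1<j\le n$, the $j$-th generator is a vector polynomial $\boldsymbol{r}_j\in\mathbb{S}(n,N)\setminus[\mathbb{M}_1+\dots+\mathbb{M}_{j-1}]$ (this set is nonempty and the sum is direct) such that $h(\boldsymbol{r}_j)=h(\mathbb{S}(n,N)\setminus[\mathbb{M}_1+\dots+\mathbb{M}_{j-1}])$; put $\mathbb{M}_j:=\mathbb{M}(\boldsymbol{r}_j)$. *)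

theory Defs
  imports
    Complex_Main
    "HOL-Library.Extended_Real"
    "HOL-Computational_Algebra.Polynomial"
    "Jordan_Normal_Form.Matrix"
begin

text \<open>
  An \<open>n\<close>-dimensional vector polynomial is an element of \<open>carrier_vec n\<close> over the ring of complex
  polynomials. Vector components are indexed from \<open>0\<close>, so that \<open>p $ k\<close> is the component
  \<open>P\<^sub>k\<^sub>+\<^sub>1\<close>. Nodes and generators are indexed from \<open>1\<close>.
\<close>

text \<open>The degree with the convention that the zero polynomial has degree \<open>-\<infinity>\<close>.\<close>

definition poly_deg :: "complex poly \<Rightarrow> ereal" where
  "poly_deg P = (if P = 0 then -\<infinity> else ereal (real (degree P)))"

text \<open>
  The zero-based index \<open>k\<close> plays the role of \<open>j - 1\<close> in \<open>n deg P\<^sub>j + j - 1\<close>.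
  For \<open>n \<ge> 1\<close> the height of the zero vector is \<open>-\<infinity>\<close>.
\<close>

definition height :: "nat \<Rightarrow> complex poly vec \<Rightarrow> ereal" where
  "height n p = Max ((\<lambda>k. ereal (real n) * poly_deg (p $ k) + ereal (real k)) ` {..<n})"

text \<open>
  The minimum exists whenever \<open>M \<subseteq> carrier_vec n\<close> contains a nonzero element, since heights of
  nonzero vector polynomials are natural numbers; otherwise the value is irrelevant.
\<close>

definition set_height :: "nat \<Rightarrow> complex poly vec set \<Rightarrow> ereal" where
  "set_height n M = (LEAST h. \<exists>q\<in>M. q \<noteq> 0\<^sub>v n \<and> h = height n q)"

definition interp_space ::
    "nat \<Rightarrow> nat \<Rightarrow> (nat \<Rightarrow> complex) \<Rightarrow> (nat \<Rightarrow> complex vec) \<Rightarrow> complex poly vec set" where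
  "interp_space n N z \<alpha> =
     {p \<in> carrier_vec n. \<forall>j\<in>{1..N}. (\<Sum>k<n. \<alpha> j $ k * poly (p $ k) (z j)) = 0}"

text \<open>
  Linear independence of \<open>\<alpha>\<close> as a family indexed by \<open>J\<close>; in particular equal vectors at two
  different indices are dependent.
\<close>

definition lin_indep_family :: "nat \<Rightarrow> (nat \<Rightarrow> complex vec) \<Rightarrow> nat set \<Rightarrow> bool" where
  "lin_indep_family n \<alpha> J \<longleftrightarrow>
     (\<forall>c :: nat \<Rightarrow> complex. (\<forall>k<n. (\<Sum>j\<in>J. c j * \<alpha> j $ k) = 0) \<longrightarrow> (\<forall>j\<in>J. c j = 0))"

definition poly_multiples :: "complex poly vec \<Rightarrow> complex poly vec set" where
  "poly_multiples r = {S \<cdot>\<^sub>v r | S. True}"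

text \<open>\<open>multiples_sum n r j\<close> is the sum of the modules generated by \<open>r 1, \<dots>, r j\<close>.\<close>

primrec multiples_sum ::
    "nat \<Rightarrow> (nat \<Rightarrow> complex poly vec) \<Rightarrow> nat \<Rightarrow> complex poly vec set" where
  "multiples_sum n r 0 = {0\<^sub>v n}"
| "multiples_sum n r (Suc j) =
     {u + v | u v. u \<in> multiples_sum n r j \<and> v \<in> poly_multiples (r (Suc j))}"

definition generators ::
    "nat \<Rightarrow> complex poly vec set \<Rightarrow> (nat \<Rightarrow> complex poly vec) \<Rightarrow> bool" where
  "generators n \<S> r \<longleftrightarrow>
     r 1 \<in> \<S> \<and> height n (r 1) = set_height n \<S> \<and>
     (\<forall>j\<in>{2..n}. r j \<in> \<S> - multiples_sum n r (j - 1) \<and>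
        height n (r j) = set_height n (\<S> - multiples_sum n r (j - 1)))"

end

theory Submission
  imports Defs
begin

text \<open>
  Interleaving the coefficients, \<open>p \<mapsto> \<Sum>k<n. X\<^sup>k * p\<^sub>k (X\<^sup>n)\<close>, identifies vector polynomials with scalar
  polynomials in such a way that the height becomes the degree and multiplication by a scalar
  polynomial \<open>S\<close> becomes multiplication by \<open>S (X\<^sup>n)\<close>. Let \<open>D\<close> be the set of heights of the nonzero
  elements of the interpolation space. Each interpolation condition does not vanish identically on
  the space cut out by the previous ones, so imposing it removes exactly one height; hence \<open>D\<close> has
  \<open>N\<close> gaps. On the other hand, cancelling leading terms shows that the heights of the generators are
  the minimal elements of \<open>D\<close> in the \<open>n\<close> residue classes modulo \<open>n\<close>. Since \<open>D\<close> is closed under adding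
  \<open>n\<close>, a generator of height \<open>d\<close> accounts for \<open>d div n\<close> gaps, and it remains to sum
  \<open>d = n * (d div n) + d mod n\<close>.
\<close>

section \<open>Interleaving the components: heights as degrees of scalar polynomials\<close>

definition flat :: "nat \<Rightarrow> complex poly vec \<Rightarrow> complex poly" where
  "flat n p = (\<Sum>k<n. monom 1 k * pcompose (p $ k) (monom 1 n))"

lemma coeff_pcompose_monom:
  fixes p :: "'a::comm_ring_1 poly"
  assumes "n > 0"
  shows "coeff (pcompose p (monom 1 n)) m = (if n dvd m then coeff p (m div n) else 0)"
proof (induction p arbitrary: m)
  case 0
  then show ?case by simp
next
  case (pCons a p)
  show ?case
  proof (cases "m < n")
    case True
    then show ?thesis
      by (auto simp: pcompose_pCons coeff_monom_mult coeff_pCons split: nat.splits)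
  next
    case False
    then have "m div n = Suc ((m - n) div n)"
      using assms by (simp add: le_div_geq)
    moreover have "n dvd m \<longleftrightarrow> n dvd (m - n)"
      using False by (metis dvd_minus_self not_less)
    ultimately show ?thesis
      using False assms by (auto simp: pcompose_pCons coeff_monom_mult pCons.IH coeff_pCons split: nat.splits)
  qed
qed

text \<open>The summand with index \<open>k\<close> lives only in exponents congruent to
  \<open>k\<close> modulo \<open>n\<close>. As \<open>k < n\<close>, each exponent receives a
  contribution from exactly one component, so nothing is ever mixed or cancelled.\<close>

lemma coeff_flat:
  assumes "n > 0"
  shows "coeff (flat n p) m = coeff (p $ (m mod n)) (m div n)"
proof -
  have "coeff (flat n p) m = (\<Sum>k<n. if k = m mod n then coeff (p $ k) (m div n) else 0)"
    unfolding flat_def coeff_sum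
  proof (rule sum.cong[OF refl])
    fix k assume "k \<in> {..<n}"
    then have k: "k < n" by simp
    have "k = m mod n \<longleftrightarrow> k \<le> m \<and> n dvd (m - k)"
      using k by (metis mod_eq_dvd_iff_nat mod_less mod_less_eq_dividend mod_mod_trivial)
    moreover have "(m - k) div n = m div n" if "k = m mod n"
      using that assms by (simp add: minus_mod_eq_mult_div)
    ultimately show "coeff (monom 1 k * pcompose (p $ k) (monom 1 n)) m
        = (if k = m mod n then coeff (p $ k) (m div n) else 0)"
      using assms by (auto simp: coeff_monom_mult coeff_pcompose_monom)
  qed
  then show ?thesis
    using assms by simp
qed

lemma flat_add_smult:
  assumes "p \<in> carrier_vec n" "q \<in> carrier_vec n"
  shows "flat n (p + S \<cdot>\<^sub>v q) = flat n p + pcompose S (monom 1 n) * flat n q"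
  using assms
  by (simp add: flat_def pcompose_add pcompose_mult sum.distrib sum_distrib_left algebra_simps)

lemma flat_zero [simp]: "flat n (0\<^sub>v n) = 0"
  by (simp add: flat_def)

lemma flat_eq_0_iff:
  assumes "n > 0" "p \<in> carrier_vec n"
  shows "flat n p = 0 \<longleftrightarrow> p = 0\<^sub>v n"
proof
  assume flat: "flat n p = 0"
  have "coeff (p $ k) i = 0" if "k < n" for k i
    using coeff_flat[OF assms(1), of p "n * i + k"] that flat by simp
  then show "p = 0\<^sub>v n"
    using assms(2) by (intro eq_vecI) (auto simp: poly_eq_iff)
qed simp

text \<open>A nonzero component \<open>p $ k\<close> has its leading term placed at exponent
  \<open>n * degree (p $ k) + k\<close>, which is the quantity maximised in \<open>height\<close>.
  These exponents differ for different \<open>k\<close>, so the largest one survives as the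
  degree.\<close>

lemma height_eq_degree_flat:
  assumes "n > 0" "flat n p \<noteq> 0"
  shows "height n p = ereal (degree (flat n p))"
  unfolding height_def
proof (rule Max_eqI)
  let ?d = "degree (flat n p)"
  have bound: "n * degree (p $ k) + k \<le> ?d" if "k < n" "p $ k \<noteq> 0" for k
    using that assms(1) by (intro le_degree) (simp add: coeff_flat)
  show "y \<le> ereal (real ?d)"
    if y: "y \<in> (\<lambda>k. ereal (real n) * poly_deg (p $ k) + ereal (real k)) ` {..<n}" for y
  proof -
    obtain k where k: "k < n" "y = ereal (real n) * poly_deg (p $ k) + ereal (real k)"
      using y by auto
    show ?thesis
    proof (cases "p $ k = 0")
      case True
      then show ?thesis using k assms(1) by (simp add: poly_deg_def)
    next
      case False
      then have "n * degree (p $ k) + k \<le> ?d"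
        by (rule bound[OF k(1)])
      then have "real (n * degree (p $ k) + k) \<le> real ?d"
        by (simp only: of_nat_le_iff)
      then show ?thesis using k False by (simp add: poly_deg_def)
    qed
  qed
  \<comment> \<open>The maximum is attained at the component that supplies the leading coefficient
    of \<open>flat n p\<close>.\<close>
  let ?k = "?d mod n"
  have "coeff (p $ ?k) (?d div n) \<noteq> 0"
    using assms(2) coeff_flat[OF assms(1), of p ?d] by (metis leading_coeff_0_iff)
  then have nz: "p $ ?k \<noteq> 0" and deg: "?d div n \<le> degree (p $ ?k)"
    by (auto intro: le_degree)
  have k: "?k < n" using assms(1) by simp
  have "n * (?d div n) + ?k \<le> n * degree (p $ ?k) + ?k"
    using deg by (intro add_right_mono mult_le_mono2)
  then have "n * degree (p $ ?k) + ?k = ?d"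
    using bound[OF k nz] by (metis le_antisym mult_div_mod_eq)
  then have "real n * real (degree (p $ ?k)) + real ?k = real ?d"
    by (simp only: of_nat_add[symmetric] of_nat_mult[symmetric])
  then have "ereal (real n) * poly_deg (p $ ?k) + ereal (real ?k) = ereal (real ?d)"
    using nz by (simp add: poly_deg_def)
  moreover have "?k \<in> {..<n}"
    using k by simp
  ultimately show "ereal (real ?d) \<in> (\<lambda>k. ereal (real n) * poly_deg (p $ k) + ereal (real k)) ` {..<n}"
    by (rule image_eqI[OF sym])
qed simp

text \<open>Replaces the \<open>LEAST\<close> over \<open>ereal\<close> by one over the naturals,
  where well-ordering guarantees existence as soon as some witness \<open>q\<close> is present. The
  generators can then be treated purely through degrees.\<close>

lemma set_height_eq_degree_flat:
  assumes "n > 0" "M \<subseteq> carrier_vec n" "q \<in> M" "flat n q \<noteq> 0"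
    and "height n p = set_height n M"
  shows "height n p = ereal (degree (flat n p))" "flat n p \<noteq> 0"
    and "degree (flat n p) \<le> degree (flat n q)"
proof -
  define D where "D = (\<lambda>q. degree (flat n q)) ` {q \<in> M. flat n q \<noteq> 0}"
  have Least: "(LEAST d. d \<in> D) \<in> D" "(LEAST d. d \<in> D) \<le> degree (flat n q)"
    using assms(3,4) by (auto simp: D_def intro: Least_le LeastI)
  have "set_height n M = ereal (LEAST d. d \<in> D)"
    unfolding set_height_def
  proof (rule Least_equality)
    show "\<exists>q\<in>M. q \<noteq> 0\<^sub>v n \<and> ereal (LEAST d. d \<in> D) = height n q"
      using Least(1) height_eq_degree_flat[OF assms(1)]
      by (force simp: D_def simp del: ereal.inject)
  next
    fix y assume "\<exists>q\<in>M. q \<noteq> 0\<^sub>v n \<and> y = height n q"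
    then obtain q where q: "q \<in> M" "flat n q \<noteq> 0" "y = height n q"
      using flat_eq_0_iff[OF assms(1)] assms(2) by blast
    then have "(LEAST d. d \<in> D) \<le> degree (flat n q)"
      by (intro Least_le) (auto simp: D_def)
    then show "ereal (LEAST d. d \<in> D) \<le> y"
      using q height_eq_degree_flat[OF assms(1)] by simp
  qed
  then have h: "height n p = ereal (LEAST d. d \<in> D)"
    using assms(5) by simp
  show nz: "flat n p \<noteq> 0"
  proof
    \<comment> \<open>The dimension of \<open>p\<close> is unknown here, so the argument goes
      through its components: if all those below \<open>n\<close> vanish, the height is
      \<open>-\<infinity>\<close>, whereas the minimum is finite.\<close>
    assume flat: "flat n p = 0"
    have "coeff (p $ k) i = 0" if "k < n" for k i
      using coeff_flat[OF assms(1), of p "n * i + k"] that flat by simp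
    then have "p $ k = 0" if "k < n" for k
      using that by (auto simp: poly_eq_iff)
    then have "height n p = Max ((\<lambda>k. - \<infinity>) ` {..<n})"
      unfolding height_def using assms(1) by (intro arg_cong[where f=Max] image_cong) (auto simp: poly_deg_def)
    also have "\<dots> = - \<infinity>" using assms(1) by (intro Max_eqI) auto
    finally show False using h by simp
  qed
  show "height n p = ereal (degree (flat n p))"
    by (rule height_eq_degree_flat[OF assms(1) nz])
  then show "degree (flat n p) \<le> degree (flat n q)"
    using h Least(2) by simp
qed

section \<open>Degree sets of submodules\<close>

text \<open>For \<open>n > 0\<close> and \<open>V\<close> inside \<open>carrier_vec n\<close> this
  is the set of heights of the nonzero elements, as natural numbers. Its complement consists of the
  gaps counted below.\<close>

definition degs :: "nat \<Rightarrow> complex poly vec set \<Rightarrow> nat set" where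
  "degs n V = {degree (flat n p) | p. p \<in> V \<and> flat n p \<noteq> 0}"

text \<open>The one closure condition has the shape of all later cancellations. Taking
  \<open>p = q\<close> gives every multiple \<open>T \<cdot>\<^sub>v p\<close>, by the choice
  \<open>S = T - 1\<close>.\<close>

definition poly_submodule :: "nat \<Rightarrow> complex poly vec set \<Rightarrow> bool" where
  "poly_submodule n V \<longleftrightarrow> V \<subseteq> carrier_vec n \<and> (\<forall>p\<in>V. \<forall>q\<in>V. \<forall>S. p + S \<cdot>\<^sub>v q \<in> V)"

lemma poly_submoduleD:
  assumes "poly_submodule n V"
  shows "p \<in> V \<Longrightarrow> p \<in> carrier_vec n"
    and "p \<in> V \<Longrightarrow> q \<in> V \<Longrightarrow> p + S \<cdot>\<^sub>v q \<in> V"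
  using assms by (auto simp: poly_submodule_def)

lemma pcompose_monom_monom:
  assumes "n > 0"
  shows "pcompose (monom c s) (monom 1 n) = monom (c::complex) (n * s)"
  using assms by (intro poly_eqI) (auto simp: coeff_pcompose_monom, metis dvd_triv_left)

text \<open>Multiplying \<open>q\<close> by a monomial of degree \<open>s\<close> shifts the degree
  of \<open>flat n q\<close> by \<open>n * s\<close>, so the leading terms can be matched and
  removed. The case \<open>s = 0\<close> serves linear combinations over the complex numbers, the
  general case serves the module structure.\<close>

lemma cancel_leading_term:
  assumes "n > 0" "p \<in> carrier_vec n" "q \<in> carrier_vec n" "flat n q \<noteq> 0"
    and deg: "degree (flat n p) = degree (flat n q) + n * s"
  obtains c where "flat n (p + monom c s \<cdot>\<^sub>v q) = 0 \<or>
    degree (flat n (p + monom c s \<cdot>\<^sub>v q)) < degree (flat n p)"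
proof
  let ?c = "- lead_coeff (flat n p) / lead_coeff (flat n q)"
  have eq: "flat n (p + monom ?c s \<cdot>\<^sub>v q) = flat n p + monom ?c (n * s) * flat n q"
    using assms by (simp add: flat_add_smult pcompose_monom_monom)
  show "flat n (p + monom ?c s \<cdot>\<^sub>v q) = 0 \<or>
    degree (flat n (p + monom ?c s \<cdot>\<^sub>v q)) < degree (flat n p)"
  proof (rule eq_zero_or_degree_less)
    have "degree (monom ?c (n * s) * flat n q) \<le> degree (monom ?c (n * s)) + degree (flat n q)"
      by (rule degree_mult_le)
    also have "\<dots> \<le> degree (flat n p)"
      using degree_monom_le[of ?c "n * s"] deg by simp
    finally show "degree (flat n (p + monom ?c s \<cdot>\<^sub>v q)) \<le> degree (flat n p)"
      unfolding eq by (intro degree_add_le) auto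
    have "coeff (monom ?c (n * s) * flat n q) (degree (flat n p)) = ?c * lead_coeff (flat n q)"
      unfolding deg by (simp add: coeff_monom_mult)
    also have "\<dots> = - lead_coeff (flat n p)"
      using assms(4) by simp
    finally show "coeff (flat n (p + monom ?c s \<cdot>\<^sub>v q)) (degree (flat n p)) = 0"
      unfolding eq by simp
  qed
qed

text \<open>The lost degree \<open>d\<close> is the least degree of an element on which
  \<open>L\<close> does not vanish. A kernel element of degree \<open>d\<close> could be used to
  lower that minimum, and any other degree is kept by correcting its representative with a multiple
  of the minimal element. Only linearity over constants is available for \<open>L\<close>, hence the
  multipliers \<open>monom c 0\<close>.\<close>

lemma degs_kernel:
  fixes L :: "complex poly vec \<Rightarrow> complex"
  assumes "n > 0" and V: "poly_submodule n V"
    and L: "\<And>p q c. p \<in> V \<Longrightarrow> q \<in> V \<Longrightarrow> L (p + monom c 0 \<cdot>\<^sub>v q) = L p + c * L q"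
    and "q\<^sub>0 \<in> V" "L q\<^sub>0 \<noteq> 0"
  obtains d where "d \<in> degs n V" "degs n {p \<in> V. L p = 0} = degs n V - {d}"
proof -
  define P where "P d \<longleftrightarrow> (\<exists>q\<in>V. L q \<noteq> 0 \<and> degree (flat n q) = d)" for d
  define d where "d = (LEAST d. P d)"
  have "P d"
    unfolding d_def using assms(4,5) by (intro LeastI[of P "degree (flat n q\<^sub>0)"]) (auto simp: P_def)
  then obtain q where q: "q \<in> V" "L q \<noteq> 0" "degree (flat n q) = d"
    by (auto simp: P_def)
  have minimal: "d \<le> degree (flat n p)" if "p \<in> V" "L p \<noteq> 0" for p
    unfolding d_def using that by (intro Least_le) (auto simp: P_def)
  have L0: "L p = 0" if "p \<in> V" "flat n p = 0" for p
  proof -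
    have "p = 0\<^sub>v n"
      using that flat_eq_0_iff[OF assms(1)] poly_submoduleD(1)[OF V] by blast
    then show ?thesis
      \<comment> \<open>For the zero vector, linearity reads \<open>L p = L p + L p\<close>.\<close>
      using L[OF that(1) that(1), of 1] by simp
  qed
  have qnz: "flat n q \<noteq> 0"
    using q L0 by blast
  have carrier: "p \<in> carrier_vec n" if "p \<in> V" for p
    using that by (rule poly_submoduleD(1)[OF V])
  show ?thesis
  proof (rule that)
    show "d \<in> degs n V"
      using q qnz by (auto simp: degs_def)
    show "degs n {p \<in> V. L p = 0} = degs n V - {d}"
    proof (intro equalityI subsetI)
      fix e assume "e \<in> degs n {p \<in> V. L p = 0}"
      then obtain p where p: "p \<in> V" "L p = 0" "flat n p \<noteq> 0" "e = degree (flat n p)"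
        by (auto simp: degs_def)
      have "e \<noteq> d"
      proof
        \<comment> \<open>Adding a multiple of the kernel element \<open>p\<close> to
          \<open>q\<close> leaves the value of \<open>L\<close> nonzero but lowers the degree below
          \<open>d\<close>.\<close>
        assume "e = d"
        then obtain c where c: "flat n (q + monom c 0 \<cdot>\<^sub>v p) = 0 \<or>
            degree (flat n (q + monom c 0 \<cdot>\<^sub>v p)) < degree (flat n q)"
          using cancel_leading_term[OF assms(1) carrier[OF q(1)] carrier[OF p(1)] p(3), of 0] p q by auto
        have mem: "q + monom c 0 \<cdot>\<^sub>v p \<in> V"
          by (rule poly_submoduleD(2)[OF V q(1) p(1)])
        have nz: "L (q + monom c 0 \<cdot>\<^sub>v p) \<noteq> 0"
          using L[OF q(1) p(1), of c] p(2) q(2) by simp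
        show False
          using c minimal[OF mem nz] L0[OF mem] nz q(3) by auto
      qed
      then show "e \<in> degs n V - {d}"
        using p by (auto simp: degs_def)
    next
      fix e assume "e \<in> degs n V - {d}"
      then obtain p where p: "p \<in> V" "flat n p \<noteq> 0" "e = degree (flat n p)" "e \<noteq> d"
        by (auto simp: degs_def)
      show "e \<in> degs n {p \<in> V. L p = 0}"
      proof (cases "L p = 0")
        case True
        then show ?thesis using p by (auto simp: degs_def)
      next
        case False
        \<comment> \<open>Minimality gives \<open>d \<le> e\<close>, and \<open>e \<noteq> d\<close>
          makes it strict; the correction by \<open>q\<close> below therefore cannot touch the
          leading term of \<open>p\<close>.\<close>
        then have less: "degree (flat n q) < degree (flat n p)"
          using minimal[OF p(1)] p q by simp
        define c where "c = - L p / L q"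
        have "L (p + monom c 0 \<cdot>\<^sub>v q) = 0"
          using L[OF p(1) q(1), of c] q(2) by (simp add: c_def)
        moreover have "p + monom c 0 \<cdot>\<^sub>v q \<in> V"
          by (rule poly_submoduleD(2)[OF V p(1) q(1)])
        moreover have "flat n (p + monom c 0 \<cdot>\<^sub>v q) = flat n p + Polynomial.smult c (flat n q)"
          using flat_add_smult[OF carrier[OF p(1)] carrier[OF q(1)], of "monom c 0"] assms(1)
          by (simp add: pcompose_monom_monom monom_0)
        then have deg: "degree (flat n (p + monom c 0 \<cdot>\<^sub>v q)) = degree (flat n p)"
          using less degree_smult_le[of c "flat n q"] by (simp add: degree_add_eq_left)
        moreover have "flat n (p + monom c 0 \<cdot>\<^sub>v q) \<noteq> 0"
          using deg less by force
        ultimately show ?thesis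
          using p(3) unfolding degs_def
            by (intro CollectI exI[of _ "p + monom c 0 \<cdot>\<^sub>v q"]) simp
      qed
    qed
  qed
qed

section \<open>Separating a vector from an independent family\<close>

text \<open>The alternative that a linear form either lies in the span of finitely many others or is
  nonzero somewhere on their common kernel. When the vector obtained for \<open>J\<close> fails on
  the new form \<open>a j\<close>, the induction hypothesis is applied a second time, to
  \<open>b\<close> modified by a multiple of \<open>a j\<close>.\<close>

lemma separating_vector_or_span:
  fixes a :: "'i \<Rightarrow> nat \<Rightarrow> complex" and b :: "nat \<Rightarrow> complex"
  assumes "finite J"
  shows "(\<exists>\<beta>. (\<forall>j\<in>J. (\<Sum>k<n. a j k * \<beta> k) = 0) \<and> (\<Sum>k<n. b k * \<beta> k) \<noteq> 0) \<or>
         (\<exists>c. \<forall>k<n. b k = (\<Sum>j\<in>J. c j * a j k))"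
  using assms
proof (induction J arbitrary: b rule: finite_induct)
  case empty
  show ?case
  proof (cases "\<forall>k<n. b k = 0")
    case False
    then obtain i where i: "i < n" "b i \<noteq> 0" by auto
    have "(\<Sum>k<n. b k * (if k = i then 1 else 0)) = b i"
      using i(1) by (simp add: if_distrib[of "(*) (b _)"] cong: if_cong)
    then show ?thesis
      using i by (intro disjI1 exI[of _ "\<lambda>k. if k = i then 1 else 0"]) simp
  qed simp
next
  case (insert j J)
  consider \<beta> where "\<forall>i\<in>J. (\<Sum>k<n. a i k * \<beta> k) = 0" "(\<Sum>k<n. b k * \<beta> k) \<noteq> 0"
    | c where "\<forall>k<n. b k = (\<Sum>i\<in>J. c i * a i k)"
    using insert.IH[of b] by blast
  then show ?case
  proof cases
    case (2 c)
    have "(\<Sum>i\<in>insert j J. (c(j := 0)) i * a i k) = (\<Sum>i\<in>J. c i * a i k)" for k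
      using insert.hyps by (simp cong: sum.cong_simp) (intro sum.cong, auto)
    then show ?thesis
      using 2 by (intro disjI2 exI[of _ "c(j := 0)"]) simp
  next
    case (1 \<beta>)
    let ?x = "\<Sum>k<n. a j k * \<beta> k"
    show ?thesis
    proof (cases "?x = 0")
      case True
      then show ?thesis using 1 by (intro disjI1 exI[of _ \<beta>]) auto
    next
      case False
      \<comment> \<open>With this \<open>t\<close> the form \<open>b - t * a j\<close> vanishes at
        \<open>\<beta>\<close>.\<close>
      define t where "t = (\<Sum>k<n. b k * \<beta> k) / ?x"
      consider \<gamma> where "\<forall>i\<in>J. (\<Sum>k<n. a i k * \<gamma> k) = 0" "(\<Sum>k<n. (b k - t * a j k) * \<gamma> k) \<noteq> 0"
        | c where "\<forall>k<n. b k - t * a j k = (\<Sum>i\<in>J. c i * a i k)"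
        using insert.IH[of "\<lambda>k. b k - t * a j k"] by blast
      then show ?thesis
      proof cases
        case (2 c)
        have "(\<Sum>i\<in>insert j J. (c(j := t)) i * a i k) = t * a j k + (\<Sum>i\<in>J. c i * a i k)" for k
          using insert.hyps by simp (intro sum.cong, auto)
        moreover have "b k = t * a j k + (\<Sum>i\<in>J. c i * a i k)" if "k < n" for k
          using 2 that by (metis add.commute diff_add_cancel)
        ultimately show ?thesis
          by (intro disjI2 exI[of _ "c(j := t)"]) simp
      next
        case \<gamma>: (1 \<gamma>)
        \<comment> \<open>With this \<open>s\<close> the vector
          \<open>\<gamma> - s * \<beta>\<close> is annihilated by \<open>a j\<close>. On it,
          \<open>b\<close> takes the value of \<open>b - t * a j\<close> at \<open>\<gamma>\<close>,
          which is nonzero.\<close>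
        define s where "s = (\<Sum>k<n. a j k * \<gamma> k) / ?x"
        have expand: "(\<Sum>k<n. f k * (\<gamma> k - s * \<beta> k)) = (\<Sum>k<n. f k * \<gamma> k) - s * (\<Sum>k<n. f k * \<beta> k)"
          for f :: "nat \<Rightarrow> complex"
          by (simp add: algebra_simps sum_subtractf sum_distrib_left)
        have "(\<Sum>k<n. a j k * (\<gamma> k - s * \<beta> k)) = 0"
          unfolding expand using False by (simp add: s_def)
        moreover have "(\<Sum>k<n. b k * (\<gamma> k - s * \<beta> k)) = (\<Sum>k<n. b k * \<gamma> k) - t * (\<Sum>k<n. a j k * \<gamma> k)"
          unfolding expand by (simp add: s_def t_def)
        then have "(\<Sum>k<n. b k * (\<gamma> k - s * \<beta> k)) = (\<Sum>k<n. (b k - t * a j k) * \<gamma> k)"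
          by (simp add: algebra_simps sum_subtractf sum_distrib_left)
        moreover have "(\<Sum>k<n. a i k * (\<gamma> k - s * \<beta> k)) = 0" if "i \<in> J" for i
          unfolding expand using that 1 \<gamma> by simp
        ultimately show ?thesis
          using \<gamma> by (intro disjI1 exI[of _ "\<lambda>k. \<gamma> k - s * \<beta> k"]) auto
      qed
    qed
  qed
qed

lemma lin_indep_family_subset:
  assumes "lin_indep_family n \<alpha> J" "I \<subseteq> J" "finite J"
  shows "lin_indep_family n \<alpha> I"
  unfolding lin_indep_family_def
proof (intro allI impI)
  fix c :: "nat \<Rightarrow> complex"
  assume c: "\<forall>k<n. (\<Sum>j\<in>I. c j * \<alpha> j $ k) = 0"
  let ?c = "\<lambda>j. if j \<in> I then c j else 0"
  have "(\<Sum>j\<in>J. ?c j * \<alpha> j $ k) = (\<Sum>j\<in>I. c j * \<alpha> j $ k)" for k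
    using assms(2,3) by (intro sum.mono_neutral_cong_right) auto
  with c have "\<forall>k<n. (\<Sum>j\<in>J. ?c j * \<alpha> j $ k) = 0"
    by simp
  then have "\<forall>j\<in>J. ?c j = 0"
    using assms(1)[unfolded lin_indep_family_def, THEN spec, of ?c] by (rule rev_mp)
  then show "\<forall>j\<in>I. c j = 0"
    using assms(2) by (metis subsetD)
qed

text \<open>Independence rules out the span alternative: a representation of
  \<open>\<alpha> i\<close> by the other vectors would be a relation with coefficient
  \<open>- 1\<close> at \<open>i\<close>.\<close>

lemma lin_indep_family_separating:
  assumes "lin_indep_family n \<alpha> (insert i J)" "i \<notin> J" "finite J"
  obtains \<beta> where "\<forall>j\<in>J. (\<Sum>k<n. \<alpha> j $ k * \<beta> k) = 0" "(\<Sum>k<n. \<alpha> i $ k * \<beta> k) \<noteq> 0"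
proof -
  have "\<nexists>c. \<forall>k<n. \<alpha> i $ k = (\<Sum>j\<in>J. c j * \<alpha> j $ k)"
  proof
    assume "\<exists>c. \<forall>k<n. \<alpha> i $ k = (\<Sum>j\<in>J. c j * \<alpha> j $ k)"
    then obtain c where c: "\<forall>k<n. \<alpha> i $ k = (\<Sum>j\<in>J. c j * \<alpha> j $ k)" by blast
    let ?c = "c(i := - 1)"
    have "(\<Sum>j\<in>J. ?c j * \<alpha> j $ k) = (\<Sum>j\<in>J. c j * \<alpha> j $ k)" for k
      using assms(2) by (intro sum.cong) auto
    then have "(\<Sum>j\<in>insert i J. ?c j * \<alpha> j $ k) = 0" if "k < n" for k
      using assms c that by simp
    then have "\<forall>j\<in>insert i J. ?c j = 0"
      using assms(1)[unfolded lin_indep_family_def, rule_format, of ?c] by blast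
    then show False by simp
  qed
  then show ?thesis
    using separating_vector_or_span[OF assms(3), where a = "\<lambda>j k. \<alpha> j $ k" and b = "\<lambda>k. \<alpha> i $ k" and n = n] that by blast
qed

section \<open>Gaps in the degree set of the interpolation space\<close>

lemma interp_space_0: "interp_space n 0 z \<alpha> = carrier_vec n"
  by (simp add: interp_space_def)

lemma interp_space_Suc:
  "interp_space n (Suc N) z \<alpha> =
     {p \<in> interp_space n N z \<alpha>. (\<Sum>k<n. \<alpha> (Suc N) $ k * poly (p $ k) (z (Suc N))) = 0}"
  by (auto simp: interp_space_def atLeastAtMostSuc_conv)

lemma evaluation_add_smult:
  fixes p q :: "complex poly vec"
  assumes "p \<in> carrier_vec n" "q \<in> carrier_vec n"
  shows "(\<Sum>k<n. a $ k * poly ((p + S \<cdot>\<^sub>v q) $ k) w) =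
    (\<Sum>k<n. a $ k * poly (p $ k) w) + poly S w * (\<Sum>k<n. a $ k * poly (q $ k) w)"
  using assms by (simp add: algebra_simps sum.distrib sum_distrib_left)

lemma poly_submodule_interp_space: "poly_submodule n (interp_space n N z \<alpha>)"
  by (auto simp: poly_submodule_def interp_space_def evaluation_add_smult simp del: index_add_vec index_smult_vec)

lemma degs_carrier_vec:
  assumes "n > 0"
  shows "degs n (carrier_vec n) = UNIV"
proof -
  have "m \<in> degs n (carrier_vec n)" for m
  proof -
    define p :: "complex poly vec"
      where "p = vec n (\<lambda>k. if k = m mod n then monom 1 (m div n) else 0)"
    have "m div n = i div n \<and> i mod n = m mod n \<longleftrightarrow> m = i" for i
      by (metis div_mult_mod_eq)
    then have "flat n p = monom 1 m"
      using assms by (intro poly_eqI) (auto simp: coeff_flat p_def)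
    moreover have "p \<in> carrier_vec n"
      by (simp add: p_def)
    ultimately show ?thesis
      unfolding degs_def by (force simp: degree_monom_eq)
  qed
  then show ?thesis by blast
qed

text \<open>Without conditions every degree occurs. Each further condition is a linear functional
  that is nonzero on the space cut out so far, so \<open>degs_kernel\<close> adds exactly one
  gap.\<close>

lemma card_gaps_interp_space:
  assumes "n > 0"
    and "\<And>w. lin_indep_family n \<alpha> {j \<in> {1..N}. z j = w}"
  shows "finite (- degs n (interp_space n N z \<alpha>)) \<and> card (- degs n (interp_space n N z \<alpha>)) = N"
  using assms(2)
proof (induction N)
  case 0
  then show ?case using assms(1) by (simp add: interp_space_0 degs_carrier_vec)
next
  case (Suc N)
  let ?V = "interp_space n N z \<alpha>" and ?w = "z (Suc N)"
  let ?L = "\<lambda>p. \<Sum>k<n. \<alpha> (Suc N) $ k * poly (p $ k) ?w"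
  let ?J = "{j \<in> {1..N}. z j = ?w}"
  have "lin_indep_family n \<alpha> {j \<in> {1..N}. z j = w}" for w
    using Suc.prems[of w] by (rule lin_indep_family_subset) auto
  then have IH: "finite (- degs n ?V)" "card (- degs n ?V) = N"
    using Suc.IH by auto
  have "{j \<in> {1..Suc N}. z j = ?w} = insert (Suc N) ?J"
    by auto
  then have "lin_indep_family n \<alpha> (insert (Suc N) ?J)"
    using Suc.prems[of ?w] by simp
  then obtain \<beta> where \<beta>: "\<forall>j\<in>?J. (\<Sum>k<n. \<alpha> j $ k * \<beta> k) = 0"
      "(\<Sum>k<n. \<alpha> (Suc N) $ k * \<beta> k) \<noteq> 0"
    by (rule lin_indep_family_separating) auto
  \<comment> \<open>\<open>Q\<close> vanishes at the earlier nodes other than \<open>?w\<close>, and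
    \<open>\<beta>\<close> takes care of the earlier conditions at \<open>?w\<close> itself. Thus
    \<open>q\<close> meets all earlier conditions but violates the new one.\<close>
  define Q where "Q = (\<Prod>j\<in>{1..N} - ?J. [:- z j, 1:])"
  define q where "q = vec n (\<lambda>k. Polynomial.smult (\<beta> k) Q)"
  have Q: "poly Q x = (\<Prod>j\<in>{1..N} - ?J. x - z j)" for x
    by (simp add: Q_def poly_prod)
  have eval: "(\<Sum>k<n. \<alpha> j $ k * poly (q $ k) x) = poly Q x * (\<Sum>k<n. \<alpha> j $ k * \<beta> k)" for j x
    by (simp add: q_def sum_distrib_left mult_ac)
  have "poly Q (z j) = 0" if "j \<in> {1..N} - ?J" for j
    unfolding Q by (rule prod_zero) (use that in auto)
  then have "poly Q (z j) * (\<Sum>k<n. \<alpha> j $ k * \<beta> k) = 0" if "j \<in> {1..N}" for j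
    using \<beta>(1) that by (cases "j \<in> ?J") auto
  then have q: "q \<in> ?V"
    unfolding interp_space_def mem_Collect_eq eval by (simp add: q_def)
  have "poly Q ?w \<noteq> 0"
    unfolding Q by auto
  then have Lq: "?L q \<noteq> 0"
    unfolding eval using \<beta>(2) by simp
  have L: "?L (p + monom c 0 \<cdot>\<^sub>v q) = ?L p + c * ?L q" if "p \<in> ?V" "q \<in> ?V" for p q c
    using that evaluation_add_smult[of p n q "\<alpha> (Suc N)" "monom c 0" ?w]
    by (simp add: interp_space_def poly_monom)
  obtain d where d: "d \<in> degs n ?V" "degs n {p \<in> ?V. ?L p = 0} = degs n ?V - {d}"
    using degs_kernel[of n ?V ?L q, OF assms(1) poly_submodule_interp_space L q Lq] by blast
  then have "- degs n (interp_space n (Suc N) z \<alpha>) = insert d (- degs n ?V)"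
    unfolding interp_space_Suc by auto
  then show ?case
    using d(1) IH by simp
qed

section \<open>Sums of cyclic modules and the heights of the generators\<close>

lemma multiples_sum_carrier:
  assumes "\<forall>i\<in>{1..j}. r i \<in> carrier_vec n"
  shows "multiples_sum n r j \<subseteq> carrier_vec n"
  using assms by (induction j) (auto simp: poly_multiples_def)

lemma zero_in_multiples_sum:
  assumes "\<forall>i\<in>{1..j}. r i \<in> carrier_vec n"
  shows "0\<^sub>v n \<in> multiples_sum n r j"
  using assms
proof (induction j)
  case (Suc j)
  have "r (Suc j) \<in> carrier_vec n"
    using Suc.prems by simp
  then have "0\<^sub>v n = 0\<^sub>v n + 0 \<cdot>\<^sub>v r (Suc j)"
    by (intro eq_vecI) auto
  moreover have "0\<^sub>v n \<in> multiples_sum n r j"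
    using Suc by simp
  ultimately show ?case
    unfolding multiples_sum.simps poly_multiples_def by blast
qed simp

lemma multiples_sum_add:
  assumes "\<forall>i\<in>{1..j}. r i \<in> carrier_vec n" "p \<in> multiples_sum n r j" "i \<in> {1..j}"
  shows "p + S \<cdot>\<^sub>v r i \<in> multiples_sum n r j"
  using assms
proof (induction j arbitrary: p)
  case (Suc j)
  then obtain u T where u: "u \<in> multiples_sum n r j" and p: "p = u + T \<cdot>\<^sub>v r (Suc j)"
    by (auto simp: poly_multiples_def)
  have carrier: "r i \<in> carrier_vec n" "r (Suc j) \<in> carrier_vec n" "u \<in> carrier_vec n"
    using Suc.prems u multiples_sum_carrier[of j r n] by auto
  show ?case
  proof (cases "i = Suc j")
    case True
    then have "p + S \<cdot>\<^sub>v r i = u + (T + S) \<cdot>\<^sub>v r (Suc j)"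
      using carrier unfolding p by (intro eq_vecI) (auto simp: algebra_simps)
    then show ?thesis using u by (auto simp: poly_multiples_def)
  next
    case False
    have "p + S \<cdot>\<^sub>v r i = (u + S \<cdot>\<^sub>v r i) + T \<cdot>\<^sub>v r (Suc j)"
      using carrier unfolding p by (intro eq_vecI) (auto simp: algebra_simps)
    moreover have "u + S \<cdot>\<^sub>v r i \<in> multiples_sum n r j"
      using Suc False u by auto
    ultimately show ?thesis by (auto simp: poly_multiples_def)
  qed
qed simp

text \<open>A polynomial multiple of \<open>r i\<close> keeps the residue of its degree modulo
  \<open>n\<close>. Since these residues are distinct, leading terms of different summands cannot
  cancel, and one of them determines the degree of the sum.\<close>

lemma multiples_sum_residue:
  assumes "n > 0" "\<forall>i\<in>{1..j}. r i \<in> carrier_vec n"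
    and "inj_on (\<lambda>i. degree (flat n (r i)) mod n) {1..j}"
    and "p \<in> multiples_sum n r j" "flat n p \<noteq> 0"
  shows "\<exists>i\<in>{1..j}. degree (flat n p) mod n = degree (flat n (r i)) mod n"
  using assms(2-)
proof (induction j arbitrary: p)
  case (Suc j)
  then obtain u T where u: "u \<in> multiples_sum n r j" and p: "p = u + T \<cdot>\<^sub>v r (Suc j)"
    by (auto simp: poly_multiples_def)
  have carrier: "r (Suc j) \<in> carrier_vec n" "u \<in> carrier_vec n"
    using Suc.prems u multiples_sum_carrier[of j r n] by auto
  have inj: "inj_on (\<lambda>i. degree (flat n (r i)) mod n) {1..j}"
    using Suc.prems(2) by (rule inj_on_subset) auto
  define v where "v = pcompose T (monom 1 n) * flat n (r (Suc j))"
  have flat: "flat n p = flat n u + v"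
    unfolding p v_def using carrier by (simp add: flat_add_smult)
  have IH: "\<exists>i\<in>{1..j}. degree (flat n u) mod n = degree (flat n (r i)) mod n" if "flat n u \<noteq> 0"
    using Suc.IH[OF _ inj u that] Suc.prems(1) by auto
  show ?case
  proof (cases "v = 0")
    case True
    then show ?thesis using IH Suc.prems(4) flat by force
  next
    case False
    \<comment> \<open>The factor \<open>pcompose T (monom 1 n)\<close> has degree
      \<open>degree T * n\<close>.\<close>
    then have v: "degree v mod n = degree (flat n (r (Suc j))) mod n"
      unfolding v_def by (simp add: degree_mult_eq degree_pcompose degree_monom_eq)
    show ?thesis
    proof (cases "flat n u = 0")
      case True
      then show ?thesis using v flat by force
    next
      case False
      then obtain i where i: "i \<in> {1..j}" "degree (flat n u) mod n = degree (flat n (r i)) mod n"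
        using IH by blast
      have "degree (flat n (r i)) mod n \<noteq> degree (flat n (r (Suc j))) mod n"
        using inj_onD[OF Suc.prems(2), of i "Suc j"] i(1) by auto
      then have "degree (flat n u) \<noteq> degree v"
        using i(2) v by metis
      then consider "degree (flat n p) = degree (flat n u)" | "degree (flat n p) = degree v"
        unfolding flat by (metis degree_add_eq_left degree_add_eq_right linorder_neqE_nat)
      then show ?thesis
        using i v by cases auto
    qed
  qed
qed simp

text \<open>Induction on the number of generators. A repeated residue would allow a leading term to
  be cancelled by an earlier generator, against minimality. Conversely, an element of
  \<open>V\<close> whose degree has the new residue lies outside the earlier sum, so it competes in
  the minimum defining the new generator.\<close>

lemma generators_minimal:
  assumes "n > 0" and V: "poly_submodule n V" and "degs n V \<noteq> {}"
    and gens: "generators n V r" and "j \<le> n"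
  shows "inj_on (\<lambda>i. degree (flat n (r i)) mod n) {1..j} \<and>
    (\<forall>i\<in>{1..j}. r i \<in> V \<and> flat n (r i) \<noteq> 0 \<and> height n (r i) = ereal (degree (flat n (r i))) \<and>
       (\<forall>e\<in>degs n V. e mod n = degree (flat n (r i)) mod n \<longrightarrow> degree (flat n (r i)) \<le> e))"
  using assms(5)
proof (induction j)
  case 0
  then show ?case by simp
next
  case (Suc j)
  define d where "d i = degree (flat n (r i))" for i
  let ?M = "multiples_sum n r j" and ?r = "r (Suc j)"
  have inj: "inj_on (\<lambda>i. d i mod n) {1..j}"
    and IH: "\<And>i. i \<in> {1..j} \<Longrightarrow> r i \<in> V" "\<And>i. i \<in> {1..j} \<Longrightarrow> flat n (r i) \<noteq> 0"
      "\<And>i. i \<in> {1..j} \<Longrightarrow> height n (r i) = ereal (d i)"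
      "\<And>i e. i \<in> {1..j} \<Longrightarrow> e \<in> degs n V \<Longrightarrow> e mod n = d i mod n \<Longrightarrow> d i \<le> e"
    using Suc unfolding d_def by auto
  have carrier: "p \<in> carrier_vec n" if "p \<in> V" for p
    using that by (rule poly_submoduleD(1)[OF V])
  have rc: "\<forall>i\<in>{1..j}. r i \<in> carrier_vec n"
    using IH(1) carrier by blast
  have zero: "0\<^sub>v n \<in> ?M"
    by (rule zero_in_multiples_sum[OF rc])
  have nz: "flat n q \<noteq> 0" if "q \<in> V - ?M" for q
    using that zero carrier flat_eq_0_iff[OF assms(1)] by blast
  have rV: "?r \<in> V" and h: "height n ?r = set_height n (V - ?M)" and "V - ?M \<noteq> {}"
  proof -
    have *: "?r \<in> V \<and> height n ?r = set_height n (V - ?M) \<and> V - ?M \<noteq> {}"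
    proof (cases "j = 0")
      case True
      \<comment> \<open>The first generator is brought into the form of the later ones:
        \<open>multiples_sum n r 0\<close> holds only the zero vector, which
        \<open>set_height\<close> disregards.\<close>
      have "set_height n V = set_height n (V - {0\<^sub>v n})"
        unfolding set_height_def by (intro arg_cong[where f=Least] ext) auto
      moreover have "V - {0\<^sub>v n} \<noteq> {}"
        using assms(3) by (auto simp: degs_def)
      ultimately show ?thesis
        using True gens by (simp add: generators_def)
    next
      case False
      then have "Suc j \<in> {2..n}" using Suc.prems by simp
      then show ?thesis
        using gens unfolding generators_def by (metis DiffD1 diff_Suc_1 empty_iff)
    qed
    then show "?r \<in> V" "height n ?r = set_height n (V - ?M)" "V - ?M \<noteq> {}" by auto
  qed
  have sub: "V - ?M \<subseteq> carrier_vec n"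
    using carrier by blast
  obtain q where "q \<in> V - ?M" using \<open>V - ?M \<noteq> {}\<close> by blast
  note * = set_height_eq_degree_flat[OF assms(1) sub _ nz h]
  have hr: "height n ?r = ereal (d (Suc j))" and rnz: "flat n ?r \<noteq> 0"
    using *(1,2)[OF \<open>q \<in> V - ?M\<close> \<open>q \<in> V - ?M\<close>] by (auto simp: d_def)
  have min: "d (Suc j) \<le> degree (flat n q)" if "q \<in> V - ?M" for q
    unfolding d_def using *(3)[OF that that] .
  have notM: "?r \<notin> ?M"
  proof (cases "j = 0")
    case True
    then show ?thesis using rnz by auto
  next
    case False
    then have "Suc j \<in> {2..n}" using Suc.prems by simp
    then show ?thesis
      using gens unfolding generators_def by (metis DiffD2 diff_Suc_1)
  qed
  have new: "d (Suc j) mod n \<noteq> d i mod n" if i: "i \<in> {1..j}" for i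
  proof
    assume eq: "d (Suc j) mod n = d i mod n"
    have "d (Suc j) \<in> degs n V"
      using rV rnz by (auto simp: degs_def d_def)
    then have "d i \<le> d (Suc j)"
      using IH(4)[OF i _ eq] by simp
    then obtain s where s: "d (Suc j) = d i + n * s"
      using eq by (metis mod_eq_nat2E)
    have ci: "r i \<in> carrier_vec n" and cj: "?r \<in> carrier_vec n"
      using rc i rV carrier by auto
    obtain c where c: "flat n (?r + monom c s \<cdot>\<^sub>v r i) = 0 \<or>
        degree (flat n (?r + monom c s \<cdot>\<^sub>v r i)) < d (Suc j)"
      using cancel_leading_term[OF assms(1) cj ci IH(2)[OF i], of s] s unfolding d_def by blast
    let ?p = "?r + monom c s \<cdot>\<^sub>v r i"
    have "?p \<in> V"
      by (rule poly_submoduleD(2)[OF V rV IH(1)[OF i]])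
    \<comment> \<open>Otherwise undoing the cancellation inside \<open>?M\<close> would put
      \<open>?r\<close> itself into \<open>?M\<close>.\<close>
    moreover have "?p \<notin> ?M"
    proof
      assume "?p \<in> ?M"
      then have "?p + (- monom c s) \<cdot>\<^sub>v r i \<in> ?M"
        by (rule multiples_sum_add[OF rc _ i])
      moreover have "?p + (- monom c s) \<cdot>\<^sub>v r i = ?r"
        using ci cj by (intro eq_vecI) auto
      ultimately show False using notM by simp
    qed
    ultimately have "?p \<in> V - ?M" by blast
    then show False
      using c min[of ?p] nz[of ?p] by auto
  qed
  have minimal: "d (Suc j) \<le> e" if e: "e \<in> degs n V" "e mod n = d (Suc j) mod n" for e
  proof -
    obtain q where q: "q \<in> V" "flat n q \<noteq> 0" "e = degree (flat n q)"
      using e(1) by (auto simp: degs_def)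
    have "q \<notin> ?M"
      using multiples_sum_residue[OF assms(1) rc inj[unfolded d_def] _ q(2)] new e(2) q(3)
      unfolding d_def by metis
    then show ?thesis using min[of q] q by simp
  qed
  have "inj_on (\<lambda>i. d i mod n) {1..Suc j}"
    using inj new by (force simp: atLeastAtMostSuc_conv)
  then show ?case
    using IH rV rnz hr minimal unfolding d_def by (auto simp: atLeastAtMostSuc_conv)
qed

section \<open>Counting gaps by residue classes\<close>

lemma degs_add_mult:
  assumes "n > 0" "poly_submodule n V" "d \<in> degs n V"
  shows "d + n * s \<in> degs n V"
proof -
  obtain p where p: "p \<in> V" "flat n p \<noteq> 0" "d = degree (flat n p)"
    using assms(3) by (auto simp: degs_def)
  \<comment> \<open>This is the multiple of \<open>p\<close> by \<open>monom 1 s\<close>, written in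
    the shape of the closure condition.\<close>
  let ?q = "p + (monom 1 s - 1) \<cdot>\<^sub>v p"
  have "flat n ?q = monom 1 (n * s) * flat n p"
    using p(1) poly_submoduleD(1)[OF assms(2)] assms(1)
    by (simp add: flat_add_smult pcompose_diff pcompose_1 pcompose_monom_monom algebra_simps)
  moreover have "?q \<in> V"
    by (rule poly_submoduleD(2)[OF assms(2) p(1) p(1)])
  ultimately show ?thesis
    using p(2,3) unfolding degs_def
    by (intro CollectI exI[of _ ?q]) (simp add: degree_mult_eq degree_monom_eq)
qed

text \<open>In its residue class, \<open>D\<close> consists of \<open>d i\<close> and everything
  above it. The gaps there are the numbers with the same residue and quotient below
  \<open>d i div n\<close>, and the classes partition the naturals.\<close>

lemma card_gaps_residues:
  fixes D :: "nat set" and d :: "'i \<Rightarrow> nat"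
  assumes "finite I" "bij_betw (\<lambda>i. d i mod n) I {..<n}"
    and mem: "\<And>i. i \<in> I \<Longrightarrow> d i \<in> D"
    and shift: "\<And>e s. e \<in> D \<Longrightarrow> e + n * s \<in> D"
    and min: "\<And>i e. i \<in> I \<Longrightarrow> e \<in> D \<Longrightarrow> e mod n = d i mod n \<Longrightarrow> d i \<le> e"
    and "n > 0"
  shows "card (- D) = (\<Sum>i\<in>I. d i div n)"
proof -
  let ?S = "SIGMA i:I. {..<d i div n}"
  let ?f = "\<lambda>(i, t). t * n + d i mod n"
  have gap: "m \<notin> D \<longleftrightarrow> m div n < d i div n" if "i \<in> I" "m mod n = d i mod n" for i m
  proof -
    \<comment> \<open>Minimality gives one direction. For the other, \<open>m\<close> exceeds
      \<open>d i\<close> by a multiple of \<open>n\<close>.\<close>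
    have "m \<in> D \<longleftrightarrow> d i \<le> m"
      using that mem[of i] shift min[of i m] by (metis mod_eq_nat2E)
    also have "\<dots> \<longleftrightarrow> d i div n \<le> m div n"
      using that(2) by (metis div_le_mono div_mult_mod_eq add_le_mono1 mult_le_mono1)
    finally show ?thesis by (metis not_le)
  qed
  have "?f ` ?S = - D"
  proof (intro equalityI subsetI)
    fix m assume "m \<in> ?f ` ?S"
    then obtain i t where it: "i \<in> I" "t < d i div n" "m = t * n + d i mod n" by auto
    then show "m \<in> - D" using gap[of i m] assms(6) by simp
  next
    fix m assume m: "m \<in> - D"
    have "m mod n \<in> (\<lambda>i. d i mod n) ` I"
      using assms(2,6) by (simp add: bij_betw_def)
    then obtain i where i: "i \<in> I" "m mod n = d i mod n" by auto
    then have "(i, m div n) \<in> ?S" "m = ?f (i, m div n)"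
      using m gap[of i m] by (auto simp: i(2)[symmetric])
    then show "m \<in> ?f ` ?S" by (rule rev_image_eqI)
  qed
  moreover have "inj_on ?f ?S"
  proof (rule inj_onI, clarify)
    fix i t i' t'
    assume I: "i \<in> I" "i' \<in> I" and eq: "t * n + d i mod n = t' * n + d i' mod n"
    have "d i mod n = d i' mod n"
      using arg_cong[OF eq, of "\<lambda>m. m mod n"] by simp
    moreover have "t = t'"
      using arg_cong[OF eq, of "\<lambda>m. m div n"] assms(6) by simp
    ultimately show "i = i' \<and> t = t'"
      using I assms(2) by (auto simp: bij_betw_def dest: inj_onD)
  qed
  ultimately have "card (- D) = card ?S"
    by (metis card_image)
  then show ?thesis
    using assms(1) by simp
qed

theorem theorem5p2:
  fixes n N :: nat
    and z :: "nat \<Rightarrow> complex"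
    and \<alpha> :: "nat \<Rightarrow> complex vec"
    and r :: "nat \<Rightarrow> complex poly vec"
  assumes "n \<ge> 1" and "N \<ge> 1"
    and "\<And>j. j \<in> {1..N} \<Longrightarrow> \<alpha> j \<in> carrier_vec n"
    and "\<And>j. j \<in> {1..N} \<Longrightarrow> (\<Sum>k<n. cmod (\<alpha> j $ k)) > 0"
    and "\<And>w. lin_indep_family n \<alpha> {j \<in> {1..N}. z j = w}"
    and "generators n (interp_space n N z \<alpha>) r"
  shows "(\<Sum>j=1..n. height n (r j)) = ereal (real N * real n + real n * (real n - 1) / 2)"
proof -
  let ?V = "interp_space n N z \<alpha>"
  define d where "d i = degree (flat n (r i))" for i
  have n: "n > 0" using assms(1) by simp
  have V: "poly_submodule n ?V" by (rule poly_submodule_interp_space)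
  have gaps: "finite (- degs n ?V)" "card (- degs n ?V) = N"
    using card_gaps_interp_space[OF n assms(5)] by auto
  then have "degs n ?V \<noteq> {}" by auto
  note * = generators_minimal[OF n V this assms(6) le_refl, folded d_def]
  have inj: "inj_on (\<lambda>i. d i mod n) {1..n}" using * by blast
  moreover have "(\<lambda>i. d i mod n) ` {1..n} \<subseteq> {..<n}" using n by auto
  \<comment> \<open>An injection from \<open>n\<close> indices into \<open>n\<close> residues is
    onto.\<close>
  ultimately have bij: "bij_betw (\<lambda>i. d i mod n) {1..n} {..<n}"
    by (simp add: bij_betw_def card_image card_subset_eq)
  have mem: "d i \<in> degs n ?V" if "i \<in> {1..n}" for i
    using * that by (auto simp: degs_def d_def)
  have "card (- degs n ?V) = (\<Sum>i\<in>{1..n}. d i div n)"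
  proof (rule card_gaps_residues[OF _ bij mem degs_add_mult[OF n V] _ n])
    show "d i \<le> e" if "i \<in> {1..n}" "e \<in> degs n ?V" "e mod n = d i mod n" for i e
      using * that by blast
  qed auto
  then have N: "(\<Sum>i=1..n. d i div n) = N" using gaps by simp
  have res: "(\<Sum>i=1..n. d i mod n) = (\<Sum>k<n. k)"
    by (rule sum.reindex_bij_betw[OF bij])
  \<comment> \<open>The quotients sum to the number \<open>N\<close> of gaps, while the remainders
    run through all residues once.\<close>
  have "(\<Sum>i=1..n. d i) = (\<Sum>i=1..n. n * (d i div n) + d i mod n)"
    by simp
  also have "\<dots> = n * N + (\<Sum>k<n. k)"
    by (simp only: sum.distrib sum_distrib_left[symmetric] N res)
  finally have "real (\<Sum>i=1..n. d i) = real n * real N + real (\<Sum>k<n. k)"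
    by simp
  also have "real (\<Sum>k<n. k) = real n * (real n - 1) / 2"
    by (induction n) (simp_all add: field_simps)
  finally have sum: "real (\<Sum>i=1..n. d i) = real N * real n + real n * (real n - 1) / 2"
    by (simp add: mult.commute)
  have "(\<Sum>j=1..n. height n (r j)) = (\<Sum>j=1..n. ereal (real (d j)))"
    using * by (intro sum.cong) auto
  also have "\<dots> = ereal (real (\<Sum>i=1..n. d i))"
    by simp
  finally show ?thesis
    by (simp only: sum)
qed

end
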